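(* For any positive integer $n$ and any positive divisor $p$ of $n$, $$\Theta_{n}(\mathbf{x}) = \prod_{i = 0}^{n_{p} - 1} \Theta_{p}(\mathbf{y}^{(p)}_{i}).$$
   Context: Let $\mathbf{x} = (x_0, \ldots, x_{n-1})$ be variables; the identity is in $\mathbb{C}[x_0,\ldots,x_{n-1}]$. For $m \ge 1$ and elements $u_0,\ldots,u_{m-1}$ of a commutative ring, $\Theta_m(u_0,\ldots,u_{m-1})$ denotes the circulant determinant of order $m$, i.e. the determinant of the $m\times m$ matrix whose $(r,s)$ entry ($0 \le r,s \le m-1$) is $u_{(r-s) \bmod m}$. Let $\zeta_n \in \mathbb{C}$ be a primitive $n$-th root of unity. For a positive divisor $p$ of $n$ put $n_p := n/p$, and for $0 \le i \le n_p - 1$ let $\mathbf{y}^{(p)}_i := (y^{(p)}_{i,0}, \ldots, y^{(p)}_{i,p-1})$, where $$y^{(p)}_{i,j} := \sum_{l=0}^{n_p-1} \zeta_n^{i(j+pl)} x_{j+pl} \quad (0 \le j \le p-1).$$ *)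

theory Defs
  imports
    "HOL-Library.Poly_Mapping"
    "Jordan_Normal_Form.Determinant"
    Complex_Main
begin

definition circulant_mat :: "nat \<Rightarrow> (nat \<Rightarrow> 'a) \<Rightarrow> 'a mat" where
  "circulant_mat m u = mat m m (\<lambda>(r, s). u (nat ((int r - int s) mod int m)))"

definition circulant_det :: "nat \<Rightarrow> (nat \<Rightarrow> 'a::comm_ring_1) \<Rightarrow> 'a" where
  "circulant_det m u = det (circulant_mat m u)"

text \<open>
  Complex polynomials in the variables \<open>x\<^sub>0, x\<^sub>1, \<dots>\<close>: finitely supported maps from
  monomials (finitely supported exponent vectors) to coefficients, with the convolution product.
  The ring of polynomials in \<open>x\<^sub>0, \<dots>, x\<^bsub>n-1\<^esub>\<close> is the subring of those elements in which
  only these variables occur, so a polynomial identity between such elements is the same in either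
  ring.
\<close>

type_synonym cpoly = "(nat \<Rightarrow>\<^sub>0 nat) \<Rightarrow>\<^sub>0 complex"

definition Const :: "complex \<Rightarrow> cpoly" where
  "Const c = Poly_Mapping.single 0 c"

definition Var :: "nat \<Rightarrow> cpoly" where
  "Var i = Poly_Mapping.single (Poly_Mapping.single i 1) 1"

definition primitive_root_of_unity :: "nat \<Rightarrow> complex \<Rightarrow> bool" where
  "primitive_root_of_unity n z \<longleftrightarrow> n > 0 \<and> z ^ n = 1 \<and> (\<forall>k. 0 < k \<and> k < n \<longrightarrow> z ^ k \<noteq> 1)"

definition ypoly :: "complex \<Rightarrow> nat \<Rightarrow> nat \<Rightarrow> nat \<Rightarrow> nat \<Rightarrow> cpoly" where
  "ypoly \<zeta> n p i j = (\<Sum>l<n div p. Const (\<zeta> ^ (i * (j + p * l))) * Var (j + p * l))"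

end

theory Submission
  imports Defs
begin

text \<open>
  In an integral domain of characteristic zero that contains a primitive \<open>m\<close>-th root of unity
  \<open>\<omega>\<close>, the rows \<open>(\<omega>\<^bsup>kr\<^esup>)\<^sub>r\<close> of the discrete Fourier matrix are left eigenvectors of every
  circulant matrix, with eigenvalues \<open>\<Sum>j<m. \<omega>\<^bsup>kj\<^esup> u\<^sub>j\<close>. The Fourier matrix has
  nonzero determinant, because multiplying it by the matrix of inverse powers gives \<open>m\<close> times the
  identity; hence the circulant determinant is the product of these eigenvalues
  (\<open>circulant_det_eq_prod\<close>).

  The polynomial ring is such a domain, so both sides of the theorem split into linear factors.
  On the left, with \<open>\<omega> = \<zeta>\<close>, the factors are \<open>L\<^sub>t = \<Sum>s<n. \<zeta>\<^bsup>ts\<^esup> x\<^sub>s\<close>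
  for \<open>t < n\<close>. On the right put \<open>q = n div p\<close> and \<open>\<omega> = \<zeta>\<^bsup>q\<^esup>\<close>. Since
  \<open>\<zeta>\<^bsup>qp\<^esup> = 1\<close>, the factor \<open>\<zeta>\<^bsup>qkj\<^esup>\<close> equals \<open>\<zeta>\<^bsup>qk(j+pl)\<^esup>\<close>
  for every \<open>l\<close>, so the \<open>k\<close>-th eigenvalue of the \<open>i\<close>-th circulant is
  \<open>L\<^bsub>i+qk\<^esub>\<close>. Each \<open>t < n\<close> is \<open>i + qk\<close> for exactly one pair with \<open>i < q\<close> and
  \<open>k < p\<close>, so the two products have the same factors.
\<close>

lemma power_mod_of_power_eq_1:
  fixes x :: "'a::monoid_mult"
  assumes "x ^ m = 1"
  shows "x ^ (a mod m) = x ^ a"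
proof -
  have "x ^ a = x ^ (m * (a div m) + a mod m)" by simp
  also have "\<dots> = x ^ (a mod m)"
    unfolding power_add power_mult by (simp add: assms)
  finally show ?thesis by simp
qed

lemma sum_powers_root_of_unity:
  fixes x :: "'a::idom"
  assumes "x ^ m = 1" and "x \<noteq> 1"
  shows "(\<Sum>r<m. x ^ r) = 0"
proof -
  have "(x - 1) * (\<Sum>r<m. x ^ r) = 0"
    using power_diff_1_eq[of x m] assms(1) by simp
  with assms(2) show ?thesis by simp
qed

definition fourier_mat :: "nat \<Rightarrow> 'a::comm_ring_1 \<Rightarrow> 'a mat" where
  "fourier_mat m \<omega> = mat m m (\<lambda>(k, r). \<omega> ^ (k * r))"

lemma fourier_mat_carrier: "fourier_mat m \<omega> \<in> carrier_mat m m"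
  by (simp add: fourier_mat_def)

lemma det_fourier_mat_nonzero:
  fixes \<omega> :: "'a::{idom,ring_char_0}"
  assumes root: "\<omega> ^ m = 1" and prim: "\<And>k. 0 < k \<Longrightarrow> k < m \<Longrightarrow> \<omega> ^ k \<noteq> 1"
  shows "det (fourier_mat m \<omega>) \<noteq> 0"
proof -
  \<comment> \<open>The inverse of \<open>\<omega>\<close> is \<open>\<omega>\<^bsup>m-1\<^esup>\<close>, so \<open>\<omega>\<^bsup>m-l\<^esup>\<close> stands for
    \<open>\<omega>\<^bsup>-l\<^esup>\<close> without leaving the ring.\<close>
  define W where "W = mat m m (\<lambda>(r, l). \<omega> ^ ((m - l) * r))"
  have W: "W \<in> carrier_mat m m" by (simp add: W_def)
  have "fourier_mat m \<omega> * W = of_nat m \<cdot>\<^sub>m 1\<^sub>m m"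
  proof (rule eq_matI)
    fix k l assume "k < dim_row (of_nat m \<cdot>\<^sub>m 1\<^sub>m m :: 'a mat)"
      and "l < dim_col (of_nat m \<cdot>\<^sub>m 1\<^sub>m m :: 'a mat)"
    then have k: "k < m" and l: "l < m" by auto
    define x where "x = \<omega> ^ (k + (m - l))"
    have "(fourier_mat m \<omega> * W) $$ (k, l) = (\<Sum>r<m. \<omega> ^ (k * r) * \<omega> ^ ((m - l) * r))"
      using k l by (simp add: fourier_mat_def W_def scalar_prod_def atLeast0LessThan)
    also have "\<dots> = (\<Sum>r<m. x ^ r)"
      unfolding x_def by (simp add: power_add power_mult power_mult_distrib)
    also have "\<dots> = (if k = l then of_nat m else 0)"
    proof (cases "k = l")
      case True
      then have "x = 1" using l root by (simp add: x_def)
      with True show ?thesis by simp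
    next
      case False
      have "x ^ m = 1"
        unfolding x_def power_mult[symmetric] by (subst mult.commute) (simp add: power_mult root)
      moreover have "x \<noteq> 1"
      proof (cases "l < k")
        case True
        then have "k + (m - l) = (k - l) + m" using l by simp
        then have "x = \<omega> ^ (k - l)" by (simp only: x_def power_add root mult_1_right)
        then show ?thesis using prim[of "k - l"] True k by simp
      next
        case less: False
        then show ?thesis using False prim[of "k + (m - l)"] l by (simp add: x_def)
      qed
      ultimately show ?thesis using False by (simp add: sum_powers_root_of_unity)
    qed
    finally show "(fourier_mat m \<omega> * W) $$ (k, l) = (of_nat m \<cdot>\<^sub>m 1\<^sub>m m) $$ (k, l)"
      using k l by simp
  qed (auto simp: fourier_mat_def W_def)
  then have "det (fourier_mat m \<omega>) * det W = of_nat m ^ m"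
    using det_mult[OF fourier_mat_carrier W, of \<omega>] by simp
  then show ?thesis by (cases "m = 0") auto
qed

text \<open>
  The substitution \<open>j = (r - s) mod m\<close> in the \<open>s\<close>-th component of (row vector) times (circulant
  matrix) pulls out \<open>\<omega>\<^bsup>ks\<^esup>\<close>; the wrap-around is harmless as \<open>\<omega>\<^bsup>m\<^esup> = 1\<close>.
\<close>

lemma circulant_left_eigenvector:
  fixes \<omega> :: "'a::comm_ring_1"
  assumes root: "\<omega> ^ m = 1" and s: "s < m"
  shows "(\<Sum>r<m. \<omega> ^ (k * r) * u (nat ((int r - int s) mod int m)))
       = (\<Sum>j<m. \<omega> ^ (k * j) * u j) * \<omega> ^ (k * s)"
proof -
  have root_k: "(\<omega> ^ k) ^ m = 1"
    unfolding power_mult[symmetric] by (subst mult.commute) (simp add: power_mult root)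
  have fwd: "(nat ((int r - int s) mod int m) + s) mod m = r" if "r < m" for r
  proof -
    have "int ((nat ((int r - int s) mod int m) + s) mod m) = (int r - int s + int s) mod int m"
      using s by (simp add: zmod_int mod_add_left_eq)
    then show ?thesis using that by simp
  qed
  have bwd: "nat ((int ((j + s) mod m) - int s) mod int m) = j" if "j < m" for j
    using that by (simp add: zmod_int mod_diff_left_eq)
  have "(\<Sum>j<m. \<omega> ^ (k * j) * u j * \<omega> ^ (k * s))
      = (\<Sum>r<m. \<omega> ^ (k * r) * u (nat ((int r - int s) mod int m)))"
  proof (rule sum.reindex_bij_witness[where
        i = "\<lambda>r. nat ((int r - int s) mod int m)" and j = "\<lambda>j. (j + s) mod m"])
    fix j assume "j \<in> {..<m}"
    then have j: "j < m" by simp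
    have "\<omega> ^ (k * ((j + s) mod m)) = \<omega> ^ (k * j) * \<omega> ^ (k * s)"
      by (simp add: power_mult power_mod_of_power_eq_1[OF root_k] power_add)
    then show "\<omega> ^ (k * ((j + s) mod m)) * u (nat ((int ((j + s) mod m) - int s) mod int m))
        = \<omega> ^ (k * j) * u j * \<omega> ^ (k * s)"
      unfolding bwd[OF j] by (simp add: mult_ac)
  qed (use s fwd bwd in \<open>auto simp: nat_less_iff\<close>)
  then show ?thesis by (simp add: sum_distrib_right)
qed

theorem circulant_det_eq_prod:
  fixes \<omega> :: "'a::{idom,ring_char_0}"
  assumes root: "\<omega> ^ m = 1" and prim: "\<And>k. 0 < k \<Longrightarrow> k < m \<Longrightarrow> \<omega> ^ k \<noteq> 1"
  shows "circulant_det m u = (\<Prod>k<m. \<Sum>j<m. \<omega> ^ (k * j) * u j)"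
proof -
  define ev where "ev k = (\<Sum>j<m. \<omega> ^ (k * j) * u j)" for k
  define D where "D = mat m m (\<lambda>(k, l). if k = l then ev k else 0)"
  have C: "circulant_mat m u \<in> carrier_mat m m" by (simp add: circulant_mat_def)
  have D: "D \<in> carrier_mat m m" by (simp add: D_def)
  have "fourier_mat m \<omega> * circulant_mat m u = D * fourier_mat m \<omega>"
  proof (rule eq_matI)
    fix k s assume "k < dim_row (D * fourier_mat m \<omega>)" and "s < dim_col (D * fourier_mat m \<omega>)"
    then have k: "k < m" and s: "s < m" by (auto simp: D_def fourier_mat_def)
    have "(fourier_mat m \<omega> * circulant_mat m u) $$ (k, s)
        = (\<Sum>r<m. \<omega> ^ (k * r) * u (nat ((int r - int s) mod int m)))"
      using k s by (simp add: fourier_mat_def circulant_mat_def scalar_prod_def atLeast0LessThan)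
    also have "\<dots> = ev k * \<omega> ^ (k * s)"
      unfolding ev_def by (rule circulant_left_eigenvector[OF root s])
    also have "\<dots> = (\<Sum>r<m. (if k = r then ev k else 0) * \<omega> ^ (r * s))"
      using k by (simp add: if_distrib[of "\<lambda>x. x * _"] sum.delta cong: if_cong)
    also have "\<dots> = (D * fourier_mat m \<omega>) $$ (k, s)"
      using k s by (simp add: fourier_mat_def D_def scalar_prod_def atLeast0LessThan)
    finally show "(fourier_mat m \<omega> * circulant_mat m u) $$ (k, s) = (D * fourier_mat m \<omega>) $$ (k, s)" .
  qed (auto simp: D_def fourier_mat_def circulant_mat_def)
  then have "det (fourier_mat m \<omega>) * circulant_det m u = det (fourier_mat m \<omega>) * det D"
    using det_mult[OF fourier_mat_carrier C, of \<omega>] det_mult[OF D fourier_mat_carrier, of \<omega>]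
    by (auto simp: circulant_det_def mult.commute)
  then have "circulant_det m u = det D"
    using det_fourier_mat_nonzero[OF root prim] by simp
  also have "\<dots> = (\<Prod>k<m. ev k)"
  proof -
    have "upper_triangular D" by (auto simp: D_def)
    then have "det D = (\<Prod>k = 0..<dim_row D. D $$ (k, k))"
      using det_upper_triangular[OF _ D] by (simp add: prod_list_diag_prod)
    then show ?thesis by (simp add: D_def atLeast0LessThan)
  qed
  finally show ?thesis by (simp add: ev_def)
qed

lemma bij_betw_mixed_radix:
  fixes a b :: nat
  shows "bij_betw (\<lambda>(i, k). i + a * k) ({..<a} \<times> {..<b}) {..<a * b}"
proof (rule bij_betwI[where g = "\<lambda>t. (t mod a, t div a)"])
  show "(\<lambda>(i, k). i + a * k) \<in> {..<a} \<times> {..<b} \<rightarrow> {..<a * b}"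
  proof (clarsimp)
    fix i k assume "i < a" "k < b"
    then have "i + a * k < a * Suc k" and "a * Suc k \<le> a * b"
      by (simp, intro mult_le_mono) auto
    then show "i + a * k < a * b" by linarith
  qed
  show "(\<lambda>t. (t mod a, t div a)) \<in> {..<a * b} \<rightarrow> {..<a} \<times> {..<b}"
    by (auto simp: less_mult_imp_div_less mult.commute intro!: mod_less_divisor gr0I)
qed auto

lemma Const_power: "Const (c ^ k) = Const c ^ k"
proof (induction k)
  case (Suc k)
  have "Const (c * c ^ k) = Const c * Const (c ^ k)" by (simp add: Const_def mult_single)
  with Suc show ?case by simp
qed (simp add: Const_def)

lemma Const_eq_1_iff: "Const c = 1 \<longleftrightarrow> c = 1"
  by (metis Const_def lookup_single_eq single_one)

theorem theorem4:
  fixes n p :: nat and \<zeta> :: complex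
  assumes "n > 0" and "p > 0" and "p dvd n"
    and "primitive_root_of_unity n \<zeta>"
  shows "circulant_det n Var = (\<Prod>i<n div p. circulant_det p (ypoly \<zeta> n p i))"
proof -
  define q where "q = n div p"
  have n: "n = p * q" using assms(3) by (simp add: q_def)
  then have q: "q > 0" using assms(1) by simp
  define z where "z = Const \<zeta>"
  have z_root: "z ^ n = 1" and z_prim: "\<And>k. 0 < k \<Longrightarrow> k < n \<Longrightarrow> z ^ k \<noteq> 1"
    using assms(4) by (auto simp: z_def primitive_root_of_unity_def Const_eq_1_iff
        simp flip: Const_power)
  have w_root: "(z ^ q) ^ p = 1"
    using z_root by (simp add: n mult.commute flip: power_mult)
  have w_prim: "(z ^ q) ^ k \<noteq> 1" if "0 < k" "k < p" for k
    using z_prim[of "q * k"] that q by (simp add: n mult.commute flip: power_mult)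
  define L where "L t = (\<Sum>s<n. z ^ (t * s) * Var s)" for t
  have eigenvalue: "(\<Sum>j<p. (z ^ q) ^ (k * j) * ypoly \<zeta> n p i j) = L (i + q * k)" for i k
  proof -
    have "(\<Sum>j<p. (z ^ q) ^ (k * j) * ypoly \<zeta> n p i j)
        = (\<Sum>j<p. \<Sum>l<q. z ^ ((i + q * k) * (j + p * l)) * Var (j + p * l))"
    proof (intro sum.cong refl)
      fix j
      have "(z ^ q) ^ (k * j) * z ^ (i * (j + p * l)) = z ^ ((i + q * k) * (j + p * l))" for l
      proof -
        have "(i + q * k) * (j + p * l) = q * (k * j) + i * (j + p * l) + n * (k * l)"
          by (simp add: n algebra_simps)
        then show ?thesis by (simp add: power_add power_mult[of z n] power_mult[of z q] z_root)
      qed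
      then show "(z ^ q) ^ (k * j) * ypoly \<zeta> n p i j
          = (\<Sum>l<q. z ^ ((i + q * k) * (j + p * l)) * Var (j + p * l))"
        by (simp add: ypoly_def sum_distrib_left Const_power flip: q_def z_def mult.assoc)
    qed
    also have "\<dots> = (\<Sum>(j, l)\<in>{..<p} \<times> {..<q}. z ^ ((i + q * k) * (j + p * l)) * Var (j + p * l))"
      by (rule sum.cartesian_product)
    also have "\<dots> = L (i + q * k)"
      unfolding L_def n sum.reindex_bij_betw[OF bij_betw_mixed_radix, symmetric]
      by (simp add: case_prod_unfold)
    finally show ?thesis .
  qed
  have "circulant_det n Var = (\<Prod>t<q * p. L t)"
    unfolding L_def using circulant_det_eq_prod[OF z_root z_prim] by (simp add: n mult.commute)
  also have "\<dots> = (\<Prod>(i, k)\<in>{..<q} \<times> {..<p}. L (i + q * k))"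
    unfolding prod.reindex_bij_betw[OF bij_betw_mixed_radix, symmetric]
    by (simp add: case_prod_unfold)
  also have "\<dots> = (\<Prod>i<q. \<Prod>k<p. L (i + q * k))"
    by (rule prod.cartesian_product[symmetric])
  also have "\<dots> = (\<Prod>i<q. circulant_det p (ypoly \<zeta> n p i))"
    by (simp add: circulant_det_eq_prod[OF w_root w_prim] eigenvalue)
  finally show ?thesis by (simp add: q_def)
qed

end
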